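(* For any positive integer $n$, we have $$DSOME(n)\equiv 3\sum_{r=0}^{n-1}p_d(r)\left(\sigma_3(n-r)+2\sigma(n-r)\right)\pmod 8.$$
   Context: $DSOME(n)$ denotes the sum of all the odd parts in all the partitions of $n$ into distinct parts minus the sum of all the even parts in all those same partitions, with $DSOME(0)=0$. Equivalently, $\sum_{n\ge 0}DSOME(n)q^n=\prod_{j\ge1}(1+q^j)\cdot\sum_{m\ge 1}\frac{(-1)^{m-1}q^m}{(1+q^m)^2}$. Also, $p_d(n)$ denotes the number of partitions of $n$ into distinct parts, with $p_d(0)=1$, so that $\sum_{n\ge0}p_d(n)q^n=\prod_{j\ge1}(1+q^j)$. For a positive integer $n$, $\sigma_3(n)=\sum_{j\mid n}j^3$ and $\sigma(n)=\sum_{j\mid n}j$, the sums being over positive divisors of $n$. *)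

theory Defs
  imports "HOL-Library.Multiset" "HOL-Number_Theory.Cong"
begin

text \<open>A partition is the multiset of its (positive) parts.\<close>

definition partitions :: "nat \<Rightarrow> nat multiset set" where
  "partitions n = {P. 0 \<notin># P \<and> sum_mset P = n}"

definition distinct_partitions :: "nat \<Rightarrow> nat multiset set" where
  "distinct_partitions n = {P \<in> partitions n. \<forall>k. count P k \<le> 1}"

definition p_d :: "nat \<Rightarrow> nat" where
  "p_d n = card (distinct_partitions n)"

definition DSOME :: "nat \<Rightarrow> int" where
  "DSOME n =
     int (\<Sum>P\<in>distinct_partitions n. sum_mset (filter_mset odd P))
   - int (\<Sum>P\<in>distinct_partitions n. sum_mset (filter_mset even P))"

definition divisor_sigma :: "nat \<Rightarrow> nat \<Rightarrow> nat" where
  "divisor_sigma k n = (\<Sum>j | j dvd n. j ^ k)"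

text \<open>Finiteness ensures that \<open>p_d\<close> and \<open>DSOME\<close> take no default values of
  \<^const>\<open>card\<close> and \<^const>\<open>sum\<close> on infinite sets.\<close>

lemma finite_distinct_partitions: "finite (distinct_partitions n)"
proof (rule finite_subset)
  show "distinct_partitions n \<subseteq> mset_set ` Pow {..n}"
  proof
    fix P assume P: "P \<in> distinct_partitions n"
    have "P = mset_set (set_mset P)"
    proof (rule multiset_eqI)
      fix k
      have "count P k \<le> 1"
        using P by (simp add: distinct_partitions_def)
      then show "count P k = count (mset_set (set_mset P)) k"
        by (cases "k \<in># P") (auto simp: not_in_iff simp flip: count_greater_zero_iff)
    qed
    moreover have "set_mset P \<subseteq> {..n}"
      using P by (auto simp: distinct_partitions_def partitions_def dest: multi_member_split)
    ultimately show "P \<in> mset_set ` Pow {..n}" by blast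
  qed
qed simp

lemma p_d_0: "p_d 0 = 1"
proof -
  have "distinct_partitions 0 = {{#}}"
    by (auto simp: distinct_partitions_def partitions_def) (metis all_not_in_conv set_mset_eq_empty_iff)
  then show ?thesis by (simp add: p_d_def)
qed

lemma DSOME_0: "DSOME 0 = 0"
proof -
  have "distinct_partitions 0 = {{#}}"
    by (auto simp: distinct_partitions_def partitions_def) (metis all_not_in_conv set_mset_eq_empty_iff)
  then show ?thesis by (simp add: DSOME_def)
qed

end

theory Submission
  imports Defs
begin

text \<open>
  Counting the pairs of a partition \<open>P\<close> of \<open>n\<close> into distinct parts and a part \<open>j\<close> of \<open>P\<close>, with
  weight \<open>(-1)\<^bsup>j+1\<^esup> j\<close>, gives \<open>DSOME n\<close>. For fixed \<open>j\<close>, removing the part \<open>j\<close> turns the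
  partitions of \<open>n\<close> that contain \<open>j\<close> into the partitions of \<open>n - j\<close> that avoid \<open>j\<close>. Iterating this
  complementation expresses their number as the alternating sum
  \<open>p_d (n - j) - p_d (n - 2 j) + p_d (n - 3 j) - \<dots>\<close>, which is the coefficient form of expanding
  \<open>q\<^sup>j / (1 + q\<^sup>j)\<close> as a geometric series. Collecting the terms with \<open>j k = m\<close> yields the exact
  convolution identity

    \<open>DSOME n = (\<Sum>m = 1..n. p_d (n - m) c(m))\<close>  with  \<open>c(m) = (\<Sum>j k = m. (-1)\<^bsup>j+k\<^esup> j)\<close>

  (lemma \<open>DSOME_convolution\<close>).

  It remains to see that \<open>c(m) \<equiv> 3 \<sigma>\<^sub>3(m) + 6 \<sigma>(m)\<close> modulo 8. This fails divisor by divisor, but the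
  error is controlled: modulo 8, the term \<open>3 j\<^sup>3 + 6 j\<close> differs from \<open>(-1)\<^bsup>j+k\<^esup> j\<close> by
  \<open>2 j [k even] - j [j even]\<close>. Summed over all factorizations \<open>m = j k\<close>, this correction vanishes,
  since \<open>(j, k) \<mapsto> (2 j, k / 2)\<close> matches the factorizations with \<open>k\<close> even to those with \<open>j\<close> even.
\<close>

section \<open>Partitions into distinct parts that contain a given part\<close>

lemma distinct_partition_eq_mset_set:
  assumes "P \<in> distinct_partitions n"
  shows "P = mset_set (set_mset P)"
proof (rule multiset_eqI)
  fix k
  have "count P k \<le> 1"
    using assms by (simp add: distinct_partitions_def)
  then show "count P k = count (mset_set (set_mset P)) k"
    by (cases "k \<in># P") (auto simp: not_in_iff simp flip: count_greater_zero_iff)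
qed

lemma set_mset_distinct_partition:
  assumes "P \<in> distinct_partitions n"
  shows "set_mset P \<subseteq> {1..n}"
proof
  fix j assume "j \<in># P"
  then show "j \<in> {1..n}"
    using assms by (cases j) (auto simp: distinct_partitions_def partitions_def dest: multi_member_split)
qed

text \<open>Deleting the part \<open>j\<close> identifies the partitions of \<open>n\<close> that contain \<open>j\<close> with those of
  \<open>n - j\<close> that avoid it.\<close>

lemma card_containing_part_rec:
  assumes "j > 0" "j \<le> n"
  shows "card {P \<in> distinct_partitions n. j \<in># P}
       + card {P \<in> distinct_partitions (n - j). j \<in># P} = p_d (n - j)"
proof -
  have "bij_betw (\<lambda>P. P - {#j#}) {P \<in> distinct_partitions n. j \<in># P}
          {P \<in> distinct_partitions (n - j). j \<notin># P}"
  proof (rule bij_betw_byWitness[where f' = "add_mset j"])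
    show "\<forall>P\<in>{P \<in> distinct_partitions n. j \<in># P}. add_mset j (P - {#j#}) = P"
      by auto
    show "\<forall>P\<in>{P \<in> distinct_partitions (n - j). j \<notin># P}. add_mset j P - {#j#} = P"
      by auto
    show "(\<lambda>P. P - {#j#}) ` {P \<in> distinct_partitions n. j \<in># P}
            \<subseteq> {P \<in> distinct_partitions (n - j). j \<notin># P}"
    proof safe
      fix P assume P: "P \<in> distinct_partitions n" "j \<in># P"
      then obtain Q where Q: "P = add_mset j Q"
        by (meson multi_member_split)
      have le: "count P k \<le> 1" for k
        using P by (simp add: distinct_partitions_def)
      have "count Q k \<le> 1" for k
        using le[of k] by (simp add: Q split: if_splits)
      then show "P - {#j#} \<in> distinct_partitions (n - j)"
        using P by (auto simp: Q distinct_partitions_def partitions_def)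
      have "count Q j = 0"
        using le[of j] by (simp add: Q)
      moreover assume "j \<in># P - {#j#}"
      ultimately show False
        by (simp add: Q flip: count_greater_zero_iff)
    qed
    show "add_mset j ` {P \<in> distinct_partitions (n - j). j \<notin># P}
            \<subseteq> {P \<in> distinct_partitions n. j \<in># P}"
      using assms by (auto simp: distinct_partitions_def partitions_def not_in_iff)
  qed
  then have "card {P \<in> distinct_partitions n. j \<in># P}
           = card {P \<in> distinct_partitions (n - j). j \<notin># P}"
    by (rule bij_betw_same_card)
  moreover have "p_d (n - j) = card {P \<in> distinct_partitions (n - j). j \<notin># P}
                             + card {P \<in> distinct_partitions (n - j). j \<in># P}"
    unfolding p_d_def
    by (subst card_Un_disjoint[symmetric])
       (auto simp: finite_distinct_partitions intro!: arg_cong[where f = card])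
  ultimately show ?thesis by simp
qed

text \<open>Unrolling the recursion: each further deletion of \<open>j\<close> contributes one term of the geometric
  series of \<open>q\<^sup>j / (1 + q\<^sup>j)\<close>, until fewer than \<open>j\<close> units are left.\<close>

lemma card_containing_part:
  assumes "j > 0"
  shows "int (card {P \<in> distinct_partitions n. j \<in># P})
       = (\<Sum>k = 1..n div j. (-1) ^ (k + 1) * int (p_d (n - j * k)))"
proof (induction n rule: less_induct)
  case (less n)
  show ?case
  proof (cases "j \<le> n")
    case False
    then have "{P \<in> distinct_partitions n. j \<in># P} = {}"
      using set_mset_distinct_partition by fastforce
    then show ?thesis
      using False by (simp only: card.empty) simp
  next
    case True
    have div: "n div j = Suc ((n - j) div j)"
      using True assms by (simp add: le_div_geq)
    have "int (card {P \<in> distinct_partitions n. j \<in># P})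
        = int (p_d (n - j)) - int (card {P \<in> distinct_partitions (n - j). j \<in># P})"
      using card_containing_part_rec[OF assms True] by linarith
    also have "\<dots> = int (p_d (n - j))
        - (\<Sum>k = 1..(n - j) div j. (-1) ^ (k + 1) * int (p_d (n - j - j * k)))"
      using less True assms by simp
    also have "\<dots> = (\<Sum>k = 1..n div j. (-1) ^ (k + 1) * int (p_d (n - j * k)))"
      unfolding div by (subst sum.atLeast_Suc_atMost)
        (simp_all add: sum.shift_bounds_cl_Suc_ivl sum_negf del: sum.cl_ivl_Suc)
    finally show ?thesis .
  qed
qed

section \<open>The convolution identity\<close>

lemma alternating_sum_of_parts:
  assumes "P \<in> distinct_partitions n"
  shows "int (sum_mset (filter_mset odd P)) - int (sum_mset (filter_mset even P))
       = (\<Sum>j\<in>set_mset P. (-1) ^ (j + 1) * int j)"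
proof -
  define A where "A = set_mset P"
  have [simp]: "finite A" by (simp add: A_def)
  have P: "P = mset_set A"
    using distinct_partition_eq_mset_set[OF assms] by (simp add: A_def)
  have "sum_mset (filter_mset Q P) = \<Sum>{j \<in> A. Q j}" for Q
    by (simp add: P sum_unfold_sum_mset)
  moreover have "(\<Sum>j\<in>A. (-1) ^ (j + 1) * int j)
      = (\<Sum>j\<in>A. if odd j then int j else 0) - (\<Sum>j\<in>A. if even j then int j else 0)"
    by (subst sum_subtractf[symmetric], rule sum.cong) auto
  ultimately show ?thesis
    by (simp add: A_def[symmetric] sum.inter_filter if_distrib[of int] cong: if_cong)
qed

lemma DSOME_eq_sum_over_parts:
  "DSOME n = (\<Sum>j = 1..n. (-1) ^ (j + 1) * int j
                * int (card {P \<in> distinct_partitions n. j \<in># P}))"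
proof -
  let ?D = "distinct_partitions n"
  have "DSOME n = (\<Sum>P\<in>?D. int (sum_mset (filter_mset odd P)) - int (sum_mset (filter_mset even P)))"
    unfolding DSOME_def of_nat_sum sum_subtractf by (rule refl)
  also have "\<dots> = (\<Sum>P\<in>?D. \<Sum>j\<in>set_mset P. (-1) ^ (j + 1) * int j)"
    by (rule sum.cong[OF refl], rule alternating_sum_of_parts)
  also have "\<dots> = (\<Sum>P\<in>?D. \<Sum>j = 1..n. if j \<in># P then (-1) ^ (j + 1) * int j else 0)"
  proof (rule sum.cong)
    fix P assume "P \<in> ?D"
    then have "set_mset P = {j \<in> {1..n}. j \<in># P}"
      using set_mset_distinct_partition by blast
    then show "(\<Sum>j\<in>set_mset P. (-1) ^ (j + 1) * int j)
             = (\<Sum>j = 1..n. if j \<in># P then (-1) ^ (j + 1) * int j else 0)"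
      using sum.inter_filter[of "{1..n}" "\<lambda>j. (-1) ^ (j + 1) * int j" "\<lambda>j. j \<in># P"]
      by (simp only: finite_atLeastAtMost)
  qed simp
  also have "\<dots> = (\<Sum>j = 1..n. \<Sum>P\<in>?D. if j \<in># P then (-1) ^ (j + 1) * int j else 0)"
    by (rule sum.swap)
  also have "\<dots> = (\<Sum>j = 1..n. (-1) ^ (j + 1) * int j * int (card {P \<in> ?D. j \<in># P}))"
    by (simp add: finite_distinct_partitions mult.commute flip: sum.inter_filter)
  finally show ?thesis .
qed

lemma sum_pairs_by_product:
  fixes f :: "nat \<Rightarrow> nat \<Rightarrow> 'a :: comm_monoid_add"
  shows "(\<Sum>j = 1..n. \<Sum>k = 1..n div j. f j k) = (\<Sum>m = 1..n. \<Sum>j | j dvd m. f j (m div j))"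
proof -
  have le: "j * k \<le> n" if "k \<le> n div j" for j k
    using that by (metis div_times_less_eq_dividend le_trans mult.commute mult_le_mono1)
  have "(\<Sum>j = 1..n. \<Sum>k = 1..n div j. f j k)
      = (\<Sum>(j, k)\<in>(SIGMA j:{1..n}. {1..n div j}). f j k)"
    by (subst sum.Sigma) auto
  also have "\<dots> = (\<Sum>(m, j)\<in>(SIGMA m:{1..n}. {j. j dvd m}). f j (m div j))"
    by (rule sum.reindex_bij_witness[where i = "\<lambda>(m, j). (j, m div j)" and j = "\<lambda>(j, k). (j * k, j)"])
       (auto simp: le div_le_mono dvd_div_eq_0_iff Suc_le_eq dvd_pos_nat
             dest: dvd_imp_le intro: dvd_imp_le[THEN le_trans] intro!: Nat.gr0I)
  also have "\<dots> = (\<Sum>m = 1..n. \<Sum>j | j dvd m. f j (m div j))"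
    by (subst sum.Sigma) auto
  finally show ?thesis .
qed

theorem DSOME_convolution:
  "DSOME n = (\<Sum>m = 1..n. int (p_d (n - m)) * (\<Sum>j | j dvd m. (-1) ^ (j + m div j) * int j))"
proof -
  have "DSOME n = (\<Sum>j = 1..n. \<Sum>k = 1..n div j. (-1) ^ (j + k) * int j * int (p_d (n - j * k)))"
    unfolding DSOME_eq_sum_over_parts
    by (rule sum.cong[OF refl], subst card_containing_part)
       (auto simp: sum_distrib_left power_add ac_simps)
  also have "\<dots> = (\<Sum>m = 1..n. \<Sum>j | j dvd m.
                     (-1) ^ (j + m div j) * int j * int (p_d (n - j * (m div j))))"
    by (rule sum_pairs_by_product)
  also have "\<dots> = (\<Sum>m = 1..n. int (p_d (n - m)) * (\<Sum>j | j dvd m. (-1) ^ (j + m div j) * int j))"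
    by (simp add: sum_distrib_left mult.commute)
  finally show ?thesis .
qed

section \<open>The divisor sum modulo 8\<close>

text \<open>Doubling maps the divisors with even codivisor bijectively onto the even divisors.\<close>

lemma sum_even_divisors:
  fixes m :: nat
  assumes "m > 0"
  shows "(\<Sum>j | j dvd m. if even j then int j else 0)
       = (\<Sum>j | j dvd m. if even (m div j) then 2 * int j else 0)"
proof -
  have fin: "finite {j. j dvd m}" using assms by simp
  have "(\<Sum>j | j dvd m \<and> even j. int j) = (\<Sum>j | j dvd m \<and> even (m div j). 2 * int j)"
    by (rule sum.reindex_bij_witness[where i = "\<lambda>j. 2 * j" and j = "\<lambda>j. j div 2"])
       (use assms in \<open>auto elim!: dvdE simp: mult.assoc\<close>)
  then show ?thesis
    using sum.inter_filter[OF fin, of "\<lambda>j. int j" even]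
      sum.inter_filter[OF fin, of "\<lambda>j. 2 * int j" "\<lambda>j. even (m div j)"] by simp
qed

text \<open>The correction has this form, rather than a value for each parity class of \<open>(j, k)\<close>, because
  for \<open>k = m div j\<close> its two parts cancel in the sum over the divisors of \<open>m\<close>, by
  \<open>sum_even_divisors\<close>.\<close>

lemma divisor_term_cong_8:
  fixes j k :: nat
  shows "[3 * (int j ^ 3 + 2 * int j)
        = (-1) ^ (j + k) * int j + (if even k then 2 * int j else 0)
            - (if even j then int j else 0)] (mod 8)"
proof -
  consider i where "j = 2 * i" | i where "j = 2 * i + 1"
    by (metis evenE oddE)
  then show ?thesis
  proof cases
    case (1 i)
    then have j: "even j" "int j = 2 * int i" by simp_all
    have "3 * (int j ^ 3 + 2 * int j)
        - ((-1) ^ (j + k) * int j + (if even k then 2 * int j else 0) - (if even j then int j else 0))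
        = 8 * (3 * int i ^ 3 + (if even k then int i else 2 * int i))"
      using j by (cases "even k") (simp_all add: power3_eq_cube)
    then show ?thesis
      unfolding cong_iff_dvd_diff by (rule dvdI)
  next
    case (2 i)
    then have j: "odd j" "int j = 2 * int i + 1" by simp_all
    \<comment> \<open>Here \<open>3 j\<^sup>3 + 5 j\<close> has to be divisible by 8; the only term of its expansion in \<open>i\<close>
        without an explicit factor 8 is \<open>4 i (i + 1)\<close>.\<close>
    have "even (int i * (int i + 1))" by simp
    then obtain c where c: "int i * (int i + 1) = 2 * c" by (rule evenE)
    have "3 * (int j ^ 3 + 2 * int j) - int j
        = 8 * (3 * int i ^ 3 + 4 * int i ^ 2 + 3 * int i + 1) + 4 * (int i * (int i + 1))"
      unfolding j(2) by (simp add: power3_eq_cube power2_eq_square algebra_simps)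
    also have "\<dots> = 8 * (3 * int i ^ 3 + 4 * int i ^ 2 + 3 * int i + 1 + c)"
      unfolding c by simp
    finally have "8 dvd 3 * (int j ^ 3 + 2 * int j) - int j" by simp
    with j(1) show ?thesis
      unfolding cong_iff_dvd_diff by (cases "even k") auto
  qed
qed

lemma alternating_divisor_sum_cong_8:
  assumes "m > 0"
  shows "[(\<Sum>j | j dvd m. (-1) ^ (j + m div j) * int j)
        = 3 * (int (divisor_sigma 3 m) + 2 * int (divisor_sigma 1 m))] (mod 8)"
proof -
  have "3 * (int (divisor_sigma 3 m) + 2 * int (divisor_sigma 1 m))
      = (\<Sum>j | j dvd m. 3 * (int j ^ 3 + 2 * int j))"
    by (simp add: divisor_sigma_def sum.distrib sum_distrib_left)
  also have "[\<dots> = (\<Sum>j | j dvd m. (-1) ^ (j + m div j) * int j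
      + (if even (m div j) then 2 * int j else 0) - (if even j then int j else 0))] (mod 8)"
    by (intro cong_sum divisor_term_cong_8)
  also have "(\<Sum>j | j dvd m. (-1) ^ (j + m div j) * int j
      + (if even (m div j) then 2 * int j else 0) - (if even j then int j else 0))
      = (\<Sum>j | j dvd m. (-1) ^ (j + m div j) * int j)"
    by (simp only: sum.distrib sum_subtractf sum_even_divisors[OF assms] add_diff_cancel_right')
  finally show ?thesis by (rule cong_sym)
qed

theorem theorem4p10:
  fixes n :: nat
  assumes "n > 0"
  shows "[DSOME n = 3 * (\<Sum>r = 0..n - 1. int (p_d r) *
           (int (divisor_sigma 3 (n - r)) + 2 * int (divisor_sigma 1 (n - r))))] (mod 8)"
proof -
  have "[DSOME n = (\<Sum>m = 1..n. int (p_d (n - m)) *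
          (3 * (int (divisor_sigma 3 m) + 2 * int (divisor_sigma 1 m))))] (mod 8)"
    unfolding DSOME_convolution
    by (intro cong_sum cong_mult cong_refl alternating_divisor_sum_cong_8) simp
  also have "(\<Sum>m = 1..n. int (p_d (n - m)) *
          (3 * (int (divisor_sigma 3 m) + 2 * int (divisor_sigma 1 m))))
      = (\<Sum>r = 0..n - 1. int (p_d r) *
          (3 * (int (divisor_sigma 3 (n - r)) + 2 * int (divisor_sigma 1 (n - r)))))"
    by (rule sum.reindex_bij_witness[where i = "\<lambda>r. n - r" and j = "\<lambda>m. n - m"])
       (use assms in auto)
  also have "\<dots> = 3 * (\<Sum>r = 0..n - 1. int (p_d r) *
          (int (divisor_sigma 3 (n - r)) + 2 * int (divisor_sigma 1 (n - r))))"
    by (simp only: sum_distrib_left mult.left_commute)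
  finally show ?thesis .
qed

end
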